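(* Let $r\ge 1$ and $0\le d\le 2r-2$ be integers. Every $d$-dimensional face of the Kostka polytope $P_r$ has at most $\prod_{i=1}^3\left\lfloor\frac{d+2+i}{3}\right\rfloor$ vertices.
   Context: For a positive integer $r$, a partition with at most $r$ parts is written as a non-increasing $r$-tuple of nonnegative integers; $\mathrm{Par}_r(n)$ is the set of such tuples with entries summing to $n$. For $\lambda,\mu\in\mathrm{Par}_r(n)$, $\lambda$ dominates $\mu$ if $\sum_{i=1}^k\lambda_i\ge\sum_{i=1}^k\mu_i$ for all $k\le r$. The $r$-Kostka cone $\mathcal{K}_r\subseteq\mathbb{R}^{2r}$ is the convex hull of all points $(\lambda_1,\dots,\lambda_r,\mu_1,\dots,\mu_r)$ with $\lambda,\mu\in\mathrm{Par}_r(n)$ for some $n$ and $\lambda$ dominating $\mu$. The Kostka polytope $P_r$ is the $(2r-2)$-dimensional polytope $\mathcal{K}_r\cap\{x:\sum_{i=1}^r(\lambda_i+\mu_i)=1\}$. *)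

theory Defs
  imports "HOL-Analysis.Analysis"
begin

text \<open>Tuples of length \<open>r\<close> are indexed by a finite, linearly ordered type \<open>'r\<close> with
  \<open>CARD('r) = r\<close>, and \<open>\<real>\<^bsup>2r\<^esup>\<close> is represented as \<open>(real ^ 'r) \<times> (real ^ 'r)\<close>.\<close>

definition Par :: "nat \<Rightarrow> (nat ^ 'r::{finite,linorder}) set" where
  "Par n = {lam. antimono (\<lambda>i. lam $ i) \<and> (\<Sum>i\<in>UNIV. lam $ i) = n}"

definition dominates :: "nat ^ 'r::{finite,linorder} \<Rightarrow> nat ^ 'r::{finite,linorder} \<Rightarrow> bool" where
  "dominates lam mu \<longleftrightarrow> (\<forall>k. (\<Sum>i\<le>k. lam $ i) \<ge> (\<Sum>i\<le>k. mu $ i))"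

definition real_vec :: "nat ^ 'r \<Rightarrow> real ^ 'r" where
  "real_vec lam = (\<chi> i. real (lam $ i))"

definition kostka_cone :: "((real ^ 'r::{finite,linorder}) \<times> (real ^ 'r::{finite,linorder})) set" where
  "kostka_cone = convex hull
     {(real_vec lam, real_vec mu) |lam mu n. lam \<in> Par n \<and> mu \<in> Par n \<and> dominates lam mu}"

definition kostka_polytope :: "((real ^ 'r::{finite,linorder}) \<times> (real ^ 'r::{finite,linorder})) set" where
  "kostka_polytope = kostka_cone \<inter> {(x, y). (\<Sum>i\<in>UNIV. x $ i + y $ i) = 1}"

end

theory Submission
  imports Defs
begin

text \<open>
  In terms of the partial sums \<open>L \<ge> M\<close> of \<open>\<lambda>\<close> and \<open>\<mu>\<close>, both concave with equal end points, the
  extreme rays of the Kostka cone are indexed by triples: \<open>L\<close> has a single kink \<open>j\<close>, and \<open>M\<close> either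
  equals \<open>L\<close> or arises from it by cutting off the kink with a chord from \<open>i < j\<close> to \<open>k > j\<close>.

  The bound holds for every finite set of vertices that spans dimension \<open>d\<close>, whether or not it comes
  from a face. Let \<open>a\<close> be the number of values of \<open>j\<close> that occur, \<open>b\<close> the number of values of \<open>k\<close>
  occurring with a most frequent \<open>j\<close>, and \<open>c\<close> the number of values of \<open>i\<close> occurring with this \<open>j\<close> and
  a most frequent such \<open>k\<close>. There are at most \<open>a b c\<close> vertices. The positions of the kinks show that
  \<open>(a - 1) + (b - 1) + c\<close> of them are linearly independent, whence \<open>a + b + c \<le> d + 3\<close>.
\<close>

section \<open>Counting and dimension\<close>

text \<open>Induction in steps of 3: lowering each factor by one expands the product into the
  elementary symmetric polynomials of \<open>a'\<close>, \<open>b'\<close>, \<open>c'\<close>. Each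
  of these is bounded separately by its value at the balanced triple of sum
  \<open>m\<close>.\<close>

lemma prod3_le_balanced:
  fixes a b c n :: nat
  assumes "a + b + c \<le> n"
  shows "a * b * c \<le> (n div 3) * ((n + 1) div 3) * ((n + 2) div 3)"
  using assms
proof (induction n arbitrary: a b c rule: less_induct)
  case (less n)
  show ?case
  proof (cases "a = 0 \<or> b = 0 \<or> c = 0")
    case False
    then obtain a' b' c' where s: "a = Suc a'" "b = Suc b'" "c = Suc c'"
      by (metis not0_implies_Suc)
    define m where "m = n - 3"
    have n: "n = m + 3" using less.prems s by (simp add: m_def)
    have le: "a' + b' + c' \<le> m" using less.prems s n by simp
    have IH: "a' * b' * c' \<le> (m div 3) * ((m + 1) div 3) * ((m + 2) div 3)"
      using less.IH[of m a' b' c'] le n by simp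
    define q where "q = m div 3"
    \<comment> \<open>The sum of the squared pairwise differences is nonnegative.\<close>
    have e2: "3 * (a' * b' + b' * c' + c' * a') \<le> m * m"
    proof -
      have "3 * (int a' * int b' + int b' * int c' + int c' * int a') \<le> (int a' + int b' + int c')\<^sup>2"
        using sum_squares_ge_zero[of "int a' - int b'" "int b' - int c'"]
          zero_le_square[of "int c' - int a'"]
        by (simp add: power2_eq_square algebra_simps)
      also have "\<dots> \<le> (int m)\<^sup>2"
        using le by (intro power_mono) auto
      finally have "int (3 * (a' * b' + b' * c' + c' * a')) \<le> int (m * m)"
        by (simp add: power2_eq_square)
      then show ?thesis by (simp only: zle_int)
    qed
    have exp: "a * b * c = a' * b' * c' + (a' * b' + b' * c' + c' * a') + (a' + b' + c') + 1"
      by (simp add: s algebra_simps)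
    consider "m = 3 * q" | "m = 3 * q + 1" | "m = 3 * q + 2"
      unfolding q_def by linarith
    then show ?thesis
    proof cases
      case 1
      then have d: "m div 3 = q" "(m+1) div 3 = q" "(m+2) div 3 = q"
        "n div 3 = q+1" "(n+1) div 3 = q+1" "(n+2) div 3 = q+1" using n by auto
      have "a' * b' + b' * c' + c' * a' \<le> 3 * (q * q)"
        using e2 1 by (simp add: algebra_simps)
      then show ?thesis using IH le 1 unfolding exp d by (simp add: algebra_simps)
    next
      case 2
      then have d: "m div 3 = q" "(m+1) div 3 = q" "(m+2) div 3 = q+1"
        "n div 3 = q+1" "(n+1) div 3 = q+1" "(n+2) div 3 = q+2" using n by auto
      have "3 * (a' * b' + b' * c' + c' * a') \<le> 3 * (3 * (q * q) + 2 * q) + 1"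
        using e2 2 by (simp add: algebra_simps)
      \<comment> \<open>Integrality absorbs the surplus 1; what remains is the exact value for the
        triple \<open>q\<close>, \<open>q\<close>, \<open>q + 1\<close>.\<close>
      then have "a' * b' + b' * c' + c' * a' \<le> 3 * (q * q) + 2 * q" by presburger
      then show ?thesis using IH le 2 unfolding exp d by (simp add: algebra_simps)
    next
      case 3
      then have d: "m div 3 = q" "(m+1) div 3 = q+1" "(m+2) div 3 = q+1"
        "n div 3 = q+1" "(n+1) div 3 = q+2" "(n+2) div 3 = q+2" using n by auto
      have "3 * (a' * b' + b' * c' + c' * a') \<le> 3 * (3 * (q * q) + 4 * q + 1) + 1"
        using e2 3 by (simp add: algebra_simps)
      then have "a' * b' + b' * c' + c' * a' \<le> 3 * (q * q) + 4 * q + 1" by presburger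
      then show ?thesis using IH le 3 unfolding exp d by (simp add: algebra_simps)
    qed
  qed auto
qed

text \<open>Pigeonhole: \<open>a\<close> is taken from a largest fibre of \<open>f\<close>.\<close>

lemma card_le_image_times_fibre:
  assumes "finite A" "A \<noteq> {}"
  obtains a where "a \<in> A" "card A \<le> card (f ` A) * card {x \<in> A. f x = f a}"
proof -
  define m where "m = Max ((\<lambda>a. card {x \<in> A. f x = f a}) ` A)"
  have "m \<in> (\<lambda>a. card {x \<in> A. f x = f a}) ` A"
    unfolding m_def using assms by (intro Max_in) auto
  then obtain a where a: "a \<in> A" "m = card {x \<in> A. f x = f a}" by auto
  have "card A = (\<Sum>y\<in>f ` A. card {x \<in> A. f x = y})"
    using sum.image_gen[OF assms(1), of "\<lambda>_. 1::nat" f] by simp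
  also have "\<dots> \<le> (\<Sum>y\<in>f ` A. m)"
    unfolding m_def using assms by (intro sum_mono Max_ge) auto
  finally show ?thesis using a that by simp
qed

text \<open>The functional \<open>g x\<close> vanishes on \<open>W\<close> and on every other
  \<open>w y\<close>, but not on \<open>w x\<close>. So each \<open>w x\<close> lies outside the
  span of the rest and adds one dimension.\<close>

lemma dim_Un_dual_family:
  fixes w :: "'b \<Rightarrow> 'a::euclidean_space" and g :: "'b \<Rightarrow> 'a \<Rightarrow> real"
  assumes "finite X" and "\<And>x. x \<in> X \<Longrightarrow> linear (g x)"
    and "\<And>x y. x \<in> X \<Longrightarrow> y \<in> X \<Longrightarrow> g x (w y) \<noteq> 0 \<longleftrightarrow> x = y"
    and "\<And>x z. x \<in> X \<Longrightarrow> z \<in> W \<Longrightarrow> g x z = 0"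
  shows "dim (W \<union> w ` X) = dim W + card X"
  using assms
proof (induction X rule: finite_induct)
  case (insert x X)
  have sub: "W \<union> w ` X \<subseteq> {z. g x z = 0}"
    using insert.prems insert.hyps by auto
  have "subspace {z. g x z = 0}"
    using insert.prems(1) by (intro linear_subspace_kernel) auto
  then have "span (W \<union> w ` X) \<subseteq> {z. g x z = 0}"
    using sub by (intro span_minimal)
  moreover have "g x (w x) \<noteq> 0" using insert.prems(2) by auto
  ultimately have "w x \<notin> span (W \<union> w ` X)" by auto
  then have "dim (insert (w x) (W \<union> w ` X)) = dim (W \<union> w ` X) + 1"
    by (simp add: dim_insert)
  moreover have "dim (W \<union> w ` X) = dim W + card X"
    using insert.prems by (intro insert.IH) auto
  ultimately show ?case using insert.hyps by simp
qed simp

text \<open>One representative is chosen for each value of \<open>f\<close> other than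
  \<open>f a0\<close>; the functionals \<open>g n\<close> show that these are independent modulo the
  fibre of \<open>a0\<close>. No functional has to detect the value \<open>f a0\<close>
  itself.\<close>

lemma dim_fibre_le:
  fixes v :: "'b \<Rightarrow> 'a::euclidean_space" and g :: "'c \<Rightarrow> 'a \<Rightarrow> real"
  assumes fin: "finite A" and a0: "a0 \<in> A"
    and lin: "\<And>n. linear (g n)"
    and g: "\<And>a n. a \<in> A \<Longrightarrow> n \<in> f ` A \<Longrightarrow> n \<noteq> f a0 \<Longrightarrow> g n (v a) \<noteq> 0 \<longleftrightarrow> f a = n"
  shows "dim (v ` {a \<in> A. f a = f a0}) + card (f ` A) \<le> dim (v ` A) + 1"
proof -
  define X where "X = f ` A - {f a0}"
  define s where "s n = (SOME a. a \<in> A \<and> f a = n)" for n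
  have s: "s n \<in> A \<and> f (s n) = n" if "n \<in> X" for n
    unfolding s_def by (rule someI_ex) (use that in \<open>auto simp: X_def\<close>)
  define W where "W = v ` {a \<in> A. f a = f a0}"
  have "dim (W \<union> (\<lambda>n. v (s n)) ` X) = dim W + card X"
  proof (rule dim_Un_dual_family[where g = g])
    show "finite X" using fin by (simp add: X_def)
    show "linear (g n)" for n by (rule lin)
    show "g m (v (s n)) \<noteq> 0 \<longleftrightarrow> m = n" if "m \<in> X" "n \<in> X" for m n
      using g[of "s n" m] s[OF that(2)] that(1) by (auto simp: X_def)
    show "g n z = 0" if n: "n \<in> X" and z: "z \<in> W" for n z
    proof -
      obtain a where "a \<in> A" "f a = f a0" "z = v a" using z unfolding W_def by blast
      then show ?thesis using g[of a n] n by (auto simp: X_def)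
    qed
  qed
  moreover have "dim (W \<union> (\<lambda>n. v (s n)) ` X) \<le> dim (v ` A)"
    using s by (intro dim_subset) (auto simp: W_def)
  moreover have "card X + 1 = card (f ` A)"
    unfolding X_def using fin a0 card_Suc_Diff1[of "f ` A" "f a0"] by simp
  ultimately show ?thesis by (simp add: W_def)
qed

section \<open>Generators of a polyhedral cone\<close>

text \<open>Rays are subtracted one at a time, each time as much as possible; every step makes
  a further constraint tight.\<close>

lemma polyhedral_cone_generated:
  fixes C :: "('a::real_vector \<Rightarrow> real) set" and v :: "'t \<Rightarrow> 'a"
  assumes finC: "finite C" and finT: "finite T"
    and lin: "\<And>c. c \<in> C \<Longrightarrow> linear c"
    and vC: "\<And>c t. c \<in> C \<Longrightarrow> t \<in> T \<Longrightarrow> c (v t) \<ge> 0"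
    and ex: "\<And>x. \<forall>c\<in>C. c x \<ge> 0 \<Longrightarrow> x \<noteq> 0 \<Longrightarrow>
      \<exists>t\<in>T. (\<exists>c\<in>C. c (v t) > 0) \<and> (\<forall>c\<in>C. c (v t) > 0 \<longrightarrow> c x > 0)"
    and x: "\<forall>c\<in>C. c x \<ge> 0"
  shows "\<exists>a. (\<forall>t\<in>T. a t \<ge> 0) \<and> x = (\<Sum>t\<in>T. a t *\<^sub>R v t)"
  using x
proof (induction "card {c\<in>C. c x > 0}" arbitrary: x rule: less_induct)
  case less
  show ?case
  proof (cases "x = 0")
    case True
    then show ?thesis by (intro exI[of _ "\<lambda>_. 0"]) simp
  next
    case False
    then obtain t where t: "t \<in> T" "\<exists>c\<in>C. c (v t) > 0" "\<forall>c\<in>C. c (v t) > 0 \<longrightarrow> c x > 0"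
      using ex less.prems by blast
    define R where "R = (\<lambda>c. c x / c (v t)) ` {c\<in>C. c (v t) > 0}"
    have R: "finite R" "R \<noteq> {}" using finC t by (auto simp: R_def)
    define e where "e = Min R"
    have "e \<in> R" unfolding e_def using R by simp
    then obtain c0 where c0: "c0 \<in> C" "c0 (v t) > 0" "e = c0 x / c0 (v t)"
      by (auto simp: R_def)
    have e0: "e \<ge> 0" using c0 less.prems by simp
    have ele: "e * c (v t) \<le> c x" if "c \<in> C" for c
    proof (cases "c (v t) > 0")
      case True
      then have "e \<le> c x / c (v t)"
        unfolding e_def using that R by (intro Min_le) (auto simp: R_def)
      then show ?thesis using True by (simp add: field_simps)
    next
      case False
      then show ?thesis using vC[OF that t(1)] less.prems that by auto
    qed
    define y where "y = x - e *\<^sub>R v t"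
    have cy: "c y = c x - e * c (v t)" if "c \<in> C" for c
      using lin[OF that] by (simp add: y_def linear_diff linear_scale)
    have y: "\<forall>c\<in>C. c y \<ge> 0" by (simp add: ele cy)
    have "c0 y = 0" "c0 x > 0" using cy[OF c0(1)] c0 t by simp_all
    moreover have "c x > 0" if "c \<in> C" "c y > 0" for c
      using cy[OF that(1)] that e0 vC[OF that(1) t(1)] by (smt (verit) mult_nonneg_nonneg)
    ultimately have "{c\<in>C. c y > 0} \<subset> {c\<in>C. c x > 0}"
      using c0(1) by (metis (mono_tags, lifting) less_irrefl mem_Collect_eq psubsetI subsetI)
    then have "card {c\<in>C. c y > 0} < card {c\<in>C. c x > 0}"
      using finC by (intro psubset_card_mono) auto
    from less.hyps[OF this y] obtain a where
      a: "\<forall>t\<in>T. a t \<ge> 0" "y = (\<Sum>t\<in>T. a t *\<^sub>R v t)" by blast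
    have "x = y + (\<Sum>s\<in>T. (if s = t then e else 0) *\<^sub>R v s)"
      using t(1) finT by (simp add: y_def if_distrib[of "\<lambda>u. u *\<^sub>R _"] cong: if_cong)
    also have "\<dots> = (\<Sum>s\<in>T. (a s + (if s = t then e else 0)) *\<^sub>R v s)"
      using a(2) by (simp add: scaleR_add_left sum.distrib)
    finally show ?thesis
      using a(1) e0 by (intro exI[of _ "\<lambda>s. a s + (if s = t then e else 0)"]) auto
  qed
qed

section \<open>Pairs of concave sequences\<close>

text \<open>Negated second difference: nonnegativity means concavity at \<open>n\<close>. At
  \<open>n = 0\<close> truncated subtraction yields \<open>f 0 - f 1\<close>, hence the recurring
  assumption \<open>0 < n\<close>.\<close>

definition kink :: "(nat \<Rightarrow> real) \<Rightarrow> nat \<Rightarrow> real" where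
  "kink f n = 2 * f n - f (n - 1) - f (n + 1)"

text \<open>Otherwise the first nonpositive value is reached by a strict descent, which concavity
  continues up to \<open>b\<close>, so that \<open>g b < 0\<close>.\<close>

lemma concave_pos_right:
  fixes g :: "nat \<Rightarrow> real"
  assumes "\<And>n. a < n \<Longrightarrow> n < b \<Longrightarrow> kink g n \<ge> 0" "g a > 0" "g b \<ge> 0" "a \<le> n" "n < b"
  shows "g n > 0"
proof (rule ccontr)
  assume "\<not> g n > 0"
  define m where "m = (LEAST m. a \<le> m \<and> \<not> g m > 0)"
  have m: "a \<le> m \<and> \<not> g m > 0" unfolding m_def
    by (rule LeastI[of _ n]) (use assms \<open>\<not> g n > 0\<close> in auto)
  have mn: "m \<le> n" unfolding m_def
    by (rule Least_le) (use assms \<open>\<not> g n > 0\<close> in auto)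
  have am: "a < m" using m assms by (metis le_neq_implies_less)
  have "g (m - 1) > 0"
    using not_less_Least[of "m - 1" "\<lambda>m. a \<le> m \<and> \<not> g m > 0"] am by (auto simp: m_def[symmetric])
  then have "m + i \<le> b \<Longrightarrow> g (m + i) < g (m + i - 1) \<and> g (m + i) \<le> 0" for i
  proof (induction i)
    case 0
    then show ?case using m by auto
  next
    case (Suc i)
    then show ?case using assms(1)[of "m + i"] am by (auto simp: kink_def)
  qed
  from this[of "b - m"] this[of "b - m - 1"] m mn assms show False by auto
qed

text \<open>Mirror image of \<open>concave_pos_right\<close>, by reversing the interval.\<close>

lemma concave_pos_left:
  fixes g :: "nat \<Rightarrow> real"
  assumes "\<And>n. a < n \<Longrightarrow> n < b \<Longrightarrow> kink g n \<ge> 0" "g a \<ge> 0" "g b > 0" "a < n" "n \<le> b"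
  shows "g n > 0"
proof -
  have "g (b - (b - n)) > 0"
  proof (rule concave_pos_right[where g = "\<lambda>n. g (b - n)" and a = 0 and b = "b - a"])
    fix m assume m: "0 < m" "m < b - a"
    then have "b - (m - 1) = b - m + 1" "b - (m + 1) = b - m - 1" by auto
    moreover have "a < b - m" "b - m < b" using m by auto
    ultimately show "kink (\<lambda>n. g (b - n)) m \<ge> 0"
      using assms(1)[of "b - m"] by (simp add: kink_def)
  qed (use assms in auto)
  then show ?thesis using assms by simp
qed

text \<open>For \<open>j = k\<close> there is no chord to cut and the choice of \<open>i\<close>
  would only rescale the ray, so \<open>i = 0\<close> is fixed as its representative.\<close>

definition triples :: "nat \<Rightarrow> (nat \<times> nat \<times> nat) set" where
  "triples r = {(i, j, k). i < j \<and> j \<le> k \<and> k \<le> r \<and> (j = k \<longrightarrow> i = 0)}"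

lemma finite_triples: "finite (triples r)"
  by (rule finite_subset[of _ "{..r} \<times> {..r} \<times> {..r}"]) (auto simp: triples_def)

text \<open>Without kinks all increments from \<open>a\<close> to \<open>Suc b\<close> agree, and
  the last one is zero.\<close>

lemma const_if_kink_eq_0:
  fixes f :: "nat \<Rightarrow> real"
  assumes "\<And>n. a < n \<Longrightarrow> n \<le> b \<Longrightarrow> kink f n = 0" "f (Suc b) = f b" "a \<le> n" "n \<le> b"
  shows "f n = f b"
proof -
  have "f (Suc (b - m)) = f (b - m)" if "a \<le> b - m" for m
    using that
  proof (induction m)
    case (Suc m)
    show ?case
    proof (cases "m < b")
      case True
      then have "Suc (b - Suc m) = b - m" "b - m - 1 = b - Suc m" by auto
      then show ?thesis using Suc assms(1)[of "b - m"] by (auto simp: kink_def)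
    next
      case False
      then show ?thesis using Suc by auto
    qed
  qed (use assms in simp)
  then have step: "f (Suc m) = f m" if "a \<le> m" "m \<le> b" for m
    using that by (metis diff_diff_cancel)
  show ?thesis
    using assms(4,3) by (induction n rule: inc_induct) (use step in auto)
qed

text \<open>Concavity makes the increments nonincreasing, and the last one is zero.\<close>

lemma mono_if_kink_nonneg:
  fixes f :: "nat \<Rightarrow> real"
  assumes "\<And>n. 0 < n \<Longrightarrow> n \<le> b \<Longrightarrow> kink f n \<ge> 0" "f (Suc b) = f b" "n \<le> b"
  shows "f n \<le> f (Suc n)"
  using assms(3)
proof (induction n rule: inc_induct)
  case (step n)
  then show ?case using assms(1)[of "Suc n"] by (auto simp: kink_def)
qed (use assms in simp)

text \<open>Finds a ray whose kinks and gap lie where those of the given pair do, so that a multiple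
  of it can be subtracted. Any kink of \<open>L\<close> serves as \<open>j\<close>; \<open>i\<close>
  and \<open>k\<close> are the kinks of \<open>M\<close> nearest to it on either side, unless
  \<open>M\<close> touches \<open>L\<close> at \<open>j\<close>.\<close>

lemma ray_below_exists:
  fixes L M :: "nat \<Rightarrow> real"
  assumes 0: "L 0 = 0" "M 0 = 0" and r: "L (Suc r) = L r" "M (Suc r) = M r" "L r = M r"
    and L: "\<And>n. 0 < n \<Longrightarrow> n \<le> r \<Longrightarrow> kink L n \<ge> 0"
    and M: "\<And>n. 0 < n \<Longrightarrow> n \<le> r \<Longrightarrow> kink M n \<ge> 0"
    and ge: "\<And>n. n \<le> r \<Longrightarrow> M n \<le> L n"
    and pos: "L r \<noteq> 0"
  obtains i j k where "(i, j, k) \<in> triples r" "kink L j > 0" "kink M k > 0" "i = 0 \<or> kink M i > 0"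
    "\<And>n. j < k \<Longrightarrow> i < n \<Longrightarrow> n < k \<Longrightarrow> M n < L n"
proof -
  have "\<exists>j. 0 < j \<and> j \<le> r \<and> kink L j > 0"
  proof (rule ccontr)
    assume "\<not> ?thesis"
    then have "kink L n = 0" if "0 < n" "n \<le> r" for n
      using L[OF that] that by fastforce
    then have "L 0 = L r" by (rule const_if_kink_eq_0) (use r in auto)
    then show False using pos 0 by simp
  qed
  then obtain j where j: "0 < j" "j \<le> r" "kink L j > 0" by blast
  show ?thesis
  proof (cases "M j = L j")
    case True
    \<comment> \<open>As \<open>M\<close> lies below \<open>L\<close> and touches it at
      \<open>j\<close>, it bends there at least as much. For \<open>j = r\<close> the bound at
      \<open>j + 1\<close> comes from the constant continuation past \<open>r\<close>.\<close>
    have "M (j + 1) \<le> L (j + 1)" "M (j - 1) \<le> L (j - 1)"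
      using ge[of "j + 1"] ge[of "j - 1"] j r by (cases "j = r"; auto)+
    then have "kink M j > 0" using j True by (auto simp: kink_def)
    then show ?thesis using j by (intro that[of 0 j j]) (auto simp: triples_def)
  next
    case False
    then have Mj: "M j < L j" using ge j by (metis less_le)
    then have jr: "j < r" using r j by (metis le_neq_implies_less less_irrefl)
    \<comment> \<open>Otherwise \<open>M\<close> would be constant from \<open>j\<close> on, giving
      \<open>L j \<le> L r = M r = M j\<close>.\<close>
    have "\<exists>k. j < k \<and> k \<le> r \<and> kink M k > 0"
    proof (rule ccontr)
      assume "\<not> ?thesis"
      then have "kink M n = 0" if "j < n" "n \<le> r" for n
        using M[of n] that by (metis gr_zeroI less_le not_less0)
      then have "M j = M r" by (rule const_if_kink_eq_0) (use r jr in auto)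
      moreover have "L j \<le> L r"
        using j(2)
      proof (induction rule: inc_induct)
        case (step n)
        then show ?case using mono_if_kink_nonneg[of r L n] L r by auto
      qed simp
      ultimately show False using Mj r by simp
    qed
    define k where "k = (LEAST k. j < k \<and> k \<le> r \<and> kink M k > 0)"
    have k: "j < k \<and> k \<le> r \<and> kink M k > 0"
      unfolding k_def by (rule LeastI_ex) fact
    have k': "kink M n = 0" if "j < n" "n < k" for n
      using not_less_Least[of n "\<lambda>k. j < k \<and> k \<le> r \<and> kink M k > 0"] that M[of n] k
      by (auto simp: k_def[symmetric])
    define I where "I = {i. i < j \<and> (i = 0 \<or> kink M i > 0)}"
    define i where "i = Max I"
    have I: "finite I" "I \<noteq> {}" using j by (auto simp: I_def)
    have "i \<in> I" unfolding i_def using I by (rule Max_in)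
    then have i: "i < j" "i = 0 \<or> kink M i > 0" by (auto simp: I_def)
    have i': "kink M n = 0" if "i < n" "n < j" for n
    proof -
      have "n \<notin> I" using Max_ge[OF I(1), of n] that by (auto simp: i_def[symmetric])
      then show ?thesis using M[of n] that j by (auto simp: I_def)
    qed
    \<comment> \<open>\<open>M\<close> is affine on both sides of \<open>j\<close> but may bend at
      \<open>j\<close> itself, so concavity of the gap is used separately on each side, starting
      from \<open>g j > 0\<close>.\<close>
    define g where "g n = L n - M n" for n
    have kg: "kink g n = kink L n - kink M n" for n by (simp add: kink_def g_def)
    have "g n > 0" if "i < n" "n < k" for n
    proof (cases "n \<le> j")
      case True
      show ?thesis
      proof (rule concave_pos_left[of i j])
        show "kink g n \<ge> 0" if "i < n" "n < j" for n
          using i'[OF that] L[of n] that j by (simp add: kg)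
      qed (use True that Mj ge[of i] i j in \<open>auto simp: g_def\<close>)
    next
      case False
      show ?thesis
      proof (rule concave_pos_right[of j k])
        show "kink g n \<ge> 0" if "j < n" "n < k" for n
          using k'[OF that] L[of n] that k by (simp add: kg)
      qed (use False that Mj ge[of k] k in \<open>auto simp: g_def\<close>)
    qed
    then show ?thesis using i j k
      by (intro that[of i j k]) (auto simp: triples_def g_def)
  qed
qed

section \<open>Partial sums of vectors\<close>

type_synonym 'r vpair = "(real, 'r) vec \<times> (real, 'r) vec"

text \<open>The zero-based position of an index, which turns the abstract order into an initial
  segment of the naturals.\<close>

definition rk :: "'r::{finite,linorder} \<Rightarrow> nat" where
  "rk i = card {..<i}"

lemma rk_less_iff:
  fixes i j :: "'r::{finite,linorder}"
  shows "rk i < rk j \<longleftrightarrow> i < j"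
proof -
  have "rk i < rk j" if "i < j" for i j :: 'r
    unfolding rk_def using that by (intro psubset_card_mono) auto
  then show ?thesis by (metis less_asym linorder_neqE)
qed

lemma rk_eq_iff: "rk i = rk j \<longleftrightarrow> i = j"
  by (metis less_irrefl linorder_neqE rk_less_iff)

lemma range_rk: "range (rk :: 'r::{finite,linorder} \<Rightarrow> nat) = {..<CARD('r)}"
proof (rule card_subset_eq)
  show "range (rk :: 'r \<Rightarrow> nat) \<subseteq> {..<CARD('r)}"
    unfolding rk_def by (auto intro!: psubset_card_mono)
  show "card (range (rk :: 'r \<Rightarrow> nat)) = card {..<CARD('r)}"
    by (simp add: card_image inj_def rk_eq_iff)
qed simp

lemma rk_less_CARD: "rk (i :: 'r::{finite,linorder}) < CARD('r)"
  using range_rk[where 'r = 'r] by blast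

lemma rk_surj:
  assumes "n < CARD('r::{finite,linorder})"
  obtains i :: "'r::{finite,linorder}" where "rk i = n"
  using assms range_rk[where 'r = 'r] by (metis imageE lessThan_iff)

lemma card_rk_less: "card {i :: 'r::{finite,linorder}. rk i < n} = min n CARD('r)"
proof -
  have "rk ` {i :: 'r. rk i < n} = range (rk :: 'r \<Rightarrow> nat) \<inter> {..<n}" by auto
  then have "rk ` {i :: 'r. rk i < n} = {..<min n CARD('r)}" unfolding range_rk by auto
  moreover have "inj_on rk {i :: 'r. rk i < n}" by (simp add: inj_on_def rk_eq_iff)
  ultimately show ?thesis by (metis card_image card_lessThan)
qed

definition psum :: "(real, 'r::{finite,linorder}) vec \<Rightarrow> nat \<Rightarrow> real" where
  "psum x n = (\<Sum>i | rk i < n. x $ i)"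

lemma psum_0 [simp]: "psum x 0 = 0"
  by (simp add: psum_def)

lemma psum_Suc_rk: "psum x (Suc (rk i)) = psum x (rk i) + x $ i"
proof -
  have "{j. rk j < Suc (rk i)} = insert i {j. rk j < rk i}"
    by (auto simp: less_Suc_eq rk_eq_iff)
  then show ?thesis by (simp add: psum_def)
qed

lemma psum_total: "CARD('r) \<le> n \<Longrightarrow> psum (x :: (real, 'r::{finite,linorder}) vec) n = (\<Sum>i\<in>UNIV. x $ i)"
  unfolding psum_def by (intro sum.cong) (auto intro: less_le_trans[OF rk_less_CARD])

lemma psum_add: "psum (x + y) n = psum x n + psum y n"
  and psum_scaleR: "psum (c *\<^sub>R x) n = c * psum x n"
  by (simp_all add: psum_def sum.distrib sum_distrib_left)

lemma psum_eq_0D: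
  assumes "\<And>n. psum x n = 0"
  shows "x = 0"
  by (simp add: vec_eq_iff) (metis add_0 assms psum_Suc_rk)

text \<open>The kink is the drop between consecutive entries. At \<open>n = CARD('r)\<close> it is
  the last entry, since partial sums stay constant from there on.\<close>

lemma kink_psum_nonneg:
  fixes x :: "(real, 'r::{finite,linorder}) vec"
  assumes "antimono (\<lambda>i. x $ i)" "\<And>i. x $ i \<ge> 0" "0 < n" "n \<le> CARD('r)"
  shows "kink (psum x) n \<ge> 0"
proof -
  obtain i :: 'r where i: "rk i = n - 1" using assms rk_surj[of "n - 1"] 
    by (metis diff_less less_le_trans zero_less_one)
  have n: "n = Suc (rk i)" using i assms by simp
  have 1: "psum x n = psum x (n - 1) + x $ i" using psum_Suc_rk[of x i] by (simp add: n)
  show ?thesis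
  proof (cases "n = CARD('r)")
    case True
    then show ?thesis using 1 assms(2)[of i] by (simp add: kink_def psum_total)
  next
    case False
    then obtain i' :: 'r where i': "rk i' = n" using assms rk_surj[of n] by (metis le_neq_implies_less)
    have "i \<le> i'" using i' n by (metis lessI less_imp_le rk_less_iff)
    then have "x $ i' \<le> x $ i" using assms(1) by (auto simp: antimono_def)
    then show ?thesis using 1 psum_Suc_rk[of x i'] i' by (simp add: kink_def)
  qed
qed

section \<open>Rays and vertices of the Kostka cone\<close>

text \<open>The fundamental weights.\<close>

definition omega :: "nat \<Rightarrow> (nat, 'r::{finite,linorder}) vec" where
  "omega j = (\<chi> i. if rk i < j then 1 else 0)"

lemma psum_omega:
  fixes n j :: nat
  assumes "j \<le> CARD('r::{finite,linorder})"
  shows "psum (real_vec (omega j :: (nat, 'r::{finite,linorder}) vec)) n = real (min n j)"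
proof -
  have "psum (real_vec (omega j :: (nat, 'r) vec)) n = (\<Sum>i \<in> {i :: 'r. rk i < n} \<inter> {i. rk i < j}. 1)"
    unfolding psum_def real_vec_def omega_def
    by (subst sum.inter_restrict) (auto intro!: sum.cong)
  also have "{i :: 'r. rk i < n} \<inter> {i. rk i < j} = {i. rk i < min n j}" by auto
  finally show ?thesis using assms by (simp only: sum_constant card_rk_less)
qed

text \<open>The factor \<open>k - i\<close> clears denominators, so that rays are pairs of integer
  vectors and can be generators of \<open>kostka_cone\<close>.\<close>

definition ray_lam :: "nat \<times> nat \<times> nat \<Rightarrow> (nat, 'r::{finite,linorder}) vec" where
  "ray_lam = (\<lambda>(i, j, k). \<chi> l. (k - i) * omega j $ l)"

definition ray_mu :: "nat \<times> nat \<times> nat \<Rightarrow> (nat, 'r::{finite,linorder}) vec" where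
  "ray_mu = (\<lambda>(i, j, k). \<chi> l. (k - j) * omega i $ l + (j - i) * omega k $ l)"

text \<open>Up to the factor \<open>k - i\<close>, \<open>ray (i, j, k)\<close> pairs \<open>\<omega>\<^sub>j\<close> with the convex combination of \<open>\<omega>\<^sub>i\<close> and
  \<open>\<omega>\<^sub>k\<close> of the same size, where \<open>\<omega>\<^sub>0 = 0\<close>. The triple \<open>(0, j, j)\<close> encodes the ray of
  \<open>(\<omega>\<^sub>j, \<omega>\<^sub>j)\<close>.\<close>

definition ray :: "nat \<times> nat \<times> nat \<Rightarrow> 'r::{finite,linorder} vpair" where
  "ray t = (real_vec (ray_lam t), real_vec (ray_mu t))"

lemma psum_ray:
  fixes i j k n :: nat
  assumes "(i, j, k) \<in> triples CARD('r::{finite,linorder})"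
  shows "psum (fst (ray (i, j, k) :: 'r vpair)) n = real (k - i) * real (min n j)"
    and "psum (snd (ray (i, j, k) :: 'r vpair)) n =
      real (k - j) * real (min n i) + real (j - i) * real (min n k)"
proof -
  have le: "i \<le> CARD('r)" "j \<le> CARD('r)" "k \<le> CARD('r)" using assms by (auto simp: triples_def)
  have "fst (ray (i, j, k)) = real (k - i) *\<^sub>R real_vec (omega j :: (nat, 'r) vec)"
    by (simp add: ray_def ray_lam_def real_vec_def vec_eq_iff)
  then show "psum (fst (ray (i, j, k) :: 'r vpair)) n = real (k - i) * real (min n j)"
    by (simp only: psum_scaleR psum_omega le)
  have "snd (ray (i, j, k)) =
      real (k - j) *\<^sub>R real_vec (omega i :: (nat, 'r) vec) + real (j - i) *\<^sub>R real_vec (omega k)"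
    by (simp add: ray_def ray_mu_def real_vec_def vec_eq_iff)
  then show "psum (snd (ray (i, j, k) :: 'r vpair)) n =
      real (k - j) * real (min n i) + real (j - i) * real (min n k)"
    by (simp only: psum_add psum_scaleR psum_omega le)
qed

lemma kink_ray:
  fixes i j k n :: nat
  assumes "(i, j, k) \<in> triples CARD('r::{finite,linorder})" "0 < n"
  shows "kink (psum (fst (ray (i, j, k) :: 'r vpair))) n =
      (if n = j then real (k - i) else 0)"
    and "kink (psum (snd (ray (i, j, k) :: 'r vpair))) n =
      (if n = i then real (k - j) else 0) + (if n = k then real (j - i) else 0)"
proof -
  \<comment> \<open>As a function of \<open>n\<close>, \<open>min n m\<close> bends only at
    \<open>m\<close>.\<close>
  have min: "2 * real (min n m) - real (min (n - 1) m) - real (min (n + 1) m) = (if n = m then 1 else 0)"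
    for m using assms(2) by (auto simp: min_def)
  have "kink (psum (fst (ray (i, j, k) :: 'r vpair))) n =
      real (k - i) * (2 * real (min n j) - real (min (n - 1) j) - real (min (n + 1) j))"
    unfolding kink_def psum_ray[OF assms(1)] by (simp only: algebra_simps)
  then show "kink (psum (fst (ray (i, j, k) :: 'r vpair))) n =
      (if n = j then real (k - i) else 0)" unfolding min by simp
  have "kink (psum (snd (ray (i, j, k) :: 'r vpair))) n =
      real (k - j) * (2 * real (min n i) - real (min (n - 1) i) - real (min (n + 1) i)) +
      real (j - i) * (2 * real (min n k) - real (min (n - 1) k) - real (min (n + 1) k))"
    unfolding kink_def psum_ray[OF assms(1)] by (simp only: algebra_simps)
  then show "kink (psum (snd (ray (i, j, k) :: 'r vpair))) n =
      (if n = i then real (k - j) else 0) + (if n = k then real (j - i) else 0)"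
    unfolding min by simp
qed

text \<open>The gap is a tent over the interval from \<open>i\<close> to \<open>k\<close> with its
  peak at \<open>j\<close>; it is flat zero if \<open>j = k\<close>.\<close>

lemma psum_ray_diff:
  fixes i j k n :: nat
  assumes "(i, j, k) \<in> triples CARD('r::{finite,linorder})"
  shows "psum (fst (ray (i, j, k) :: 'r vpair)) n -
      psum (snd (ray (i, j, k) :: 'r vpair)) n =
      (if n \<le> i \<or> k \<le> n then 0
       else if n \<le> j then real (k - j) * real (n - i) else real (j - i) * real (k - n))"
proof -
  have ijk: "i < j" "j \<le> k" using assms by (auto simp: triples_def)
  consider "n \<le> i" | "i < n" "n < k" "n \<le> j" | "j < n" "n < k" | "k \<le> n" by linarith
  then show ?thesis
    using ijk unfolding psum_ray[OF assms]
    by cases (simp_all add: min_absorb1 min_absorb2 of_nat_diff algebra_simps)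
qed


section \<open>Linear inequalities describing the cone\<close>

definition constraints :: "('r::{finite,linorder} vpair \<Rightarrow> real) set" where
  "constraints = (\<lambda>n x. kink (psum (fst x)) n) ` {0<..CARD('r)}
    \<union> (\<lambda>n x. kink (psum (snd x)) n) ` {0<..CARD('r)}
    \<union> (\<lambda>n x. psum (fst x) n - psum (snd x) n) ` {..CARD('r)}
    \<union> {\<lambda>x. psum (snd x) CARD('r) - psum (fst x) CARD('r)}"

lemma finite_constraints: "finite constraints"
  by (simp add: constraints_def)

lemma linear_kink_psum:
  "linear (\<lambda>x :: 'r::{finite,linorder} vpair. kink (psum (fst x)) n)"
  "linear (\<lambda>x :: 'r::{finite,linorder} vpair. kink (psum (snd x)) n)"
  by (auto intro!: linearI simp: kink_def psum_add psum_scaleR algebra_simps)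

lemma linear_constraints: "c \<in> constraints \<Longrightarrow> linear c"
  by (auto simp: constraints_def linear_kink_psum)
     (auto intro!: linearI simp: psum_add psum_scaleR algebra_simps)

text \<open>The last functional is the negative of the gap at \<open>CARD('r)\<close>; together they
  force equal totals.\<close>

lemma constraints_nonneg_iff:
  fixes x :: "'r::{finite,linorder} vpair"
  shows "(\<forall>c\<in>constraints. 0 \<le> c x) \<longleftrightarrow>
    (\<forall>n. 0 < n \<longrightarrow> n \<le> CARD('r) \<longrightarrow> 0 \<le> kink (psum (fst x)) n \<and> 0 \<le> kink (psum (snd x)) n) \<and>
    (\<forall>n \<le> CARD('r). psum (snd x) n \<le> psum (fst x) n) \<and>
    psum (fst x) CARD('r) = psum (snd x) CARD('r)"
  unfolding constraints_def by (auto simp: ball_Un intro!: antisym)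

lemma constraints_ray_nonneg:
  fixes c :: "'r::{finite,linorder} vpair \<Rightarrow> real"
  assumes c: "c \<in> constraints" and t: "t \<in> triples CARD('r)"
  shows "0 \<le> c (ray t)"
proof -
  obtain i j k where t': "t = (i, j, k)" by (cases t)
  note t = t[unfolded t']
  have "\<forall>c\<in>constraints. 0 \<le> c (ray (i, j, k) :: 'r vpair)"
    unfolding constraints_nonneg_iff
  proof (intro conjI allI impI)
    show "psum (snd (ray (i, j, k) :: 'r vpair)) n \<le> psum (fst (ray (i, j, k) :: 'r vpair)) n" for n
      using psum_ray_diff[OF t, of n] by (smt (verit) mult_nonneg_nonneg of_nat_0_le_iff)
    show "psum (fst (ray (i, j, k) :: 'r vpair)) CARD('r) =
        psum (snd (ray (i, j, k) :: 'r vpair)) CARD('r)"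
      using psum_ray_diff[OF t, of "CARD('r)"] t by (auto simp: triples_def)
  qed (simp_all add: kink_ray[OF t])
  then show ?thesis using c t' by blast
qed

text \<open>This is the existence hypothesis of \<open>polyhedral_cone_generated\<close>. The
  constraints positive on the ray are the kinks at \<open>j\<close>, \<open>k\<close> and positive
  \<open>i\<close>, and the gaps strictly between \<open>i\<close> and \<open>k\<close> if
  \<open>j < k\<close>; \<open>ray_below_exists\<close> makes them positive at
  \<open>x\<close>.\<close>

lemma constraints_ray_pos:
  fixes x :: "'r::{finite,linorder} vpair"
  assumes x: "\<forall>c\<in>constraints. 0 \<le> c x" and "x \<noteq> 0"
  shows "\<exists>t\<in>triples CARD('r). (\<exists>c\<in>constraints. 0 < c (ray t :: 'r vpair)) \<and>
    (\<forall>c\<in>constraints. 0 < c (ray t) \<longrightarrow> 0 < c x)"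
proof -
  define L where "L = psum (fst x)"
  define M where "M = psum (snd x)"
  note X = x[unfolded constraints_nonneg_iff, folded L_def M_def]
  have r: "L (Suc CARD('r)) = L CARD('r)" "M (Suc CARD('r)) = M CARD('r)"
    by (simp_all add: L_def M_def psum_total)
  have nz: "L CARD('r) \<noteq> 0"
  proof
    assume L0: "L CARD('r) = 0"
    \<comment> \<open>Such partial sums increase from 0 to the total, so a zero total forces all of
      them to vanish.\<close>
    have const: "psum y n = 0" if y: "\<And>n. 0 < n \<Longrightarrow> n \<le> CARD('r) \<Longrightarrow> 0 \<le> kink (psum y) n"
      and 0: "psum y CARD('r) = 0" for y :: "(real, 'r) vec" and n
    proof -
      have r: "psum y (Suc CARD('r)) = psum y CARD('r)" by (simp add: psum_total)
      have inc: "psum y n \<le> psum y (Suc n)" for n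
      proof (cases "n \<le> CARD('r)")
        case True
        then show ?thesis using mono_if_kink_nonneg[of "CARD('r)" "psum y" n] y r by auto
      next
        case False
        then show ?thesis by (simp add: psum_total)
      qed
      have mono: "psum y m \<le> psum y n" if "m \<le> n" for m n
        using inc that by (rule lift_Suc_mono_le)
      have "psum y (n + CARD('r)) = psum y CARD('r)" by (simp add: psum_total)
      then show ?thesis using mono[of n "n + CARD('r)"] mono[of 0 n] 0 by simp
    qed
    have "fst x = 0" using const[of "fst x"] X L0 by (intro psum_eq_0D) (auto simp: L_def)
    moreover have "snd x = 0" using const[of "snd x"] X L0 by (intro psum_eq_0D) (auto simp: M_def)
    ultimately show False using \<open>x \<noteq> 0\<close> by (simp add: prod_eq_iff)
  qed
  obtain i j k where t: "(i, j, k) \<in> triples CARD('r)" and jk: "kink L j > 0" "kink M k > 0"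
    and i: "i = 0 \<or> kink M i > 0" and g: "\<And>n. j < k \<Longrightarrow> i < n \<Longrightarrow> n < k \<Longrightarrow> M n < L n"
    by (rule ray_below_exists[of L M "CARD('r)"]) (use X r nz in \<open>auto simp: L_def M_def\<close>)
  have ijk: "i < j" "j \<le> k" "k \<le> CARD('r)" using t by (auto simp: triples_def)
  show ?thesis
  proof (intro bexI[OF _ t] conjI ballI impI)
    have "(\<lambda>x :: 'r vpair. kink (psum (fst x)) j) \<in> constraints"
      using ijk by (auto simp: constraints_def)
    moreover have "0 < kink (psum (fst (ray (i, j, k) :: 'r vpair))) j"
      using ijk kink_ray(1)[OF t, of j] by simp
    ultimately show "\<exists>c\<in>constraints. 0 < c (ray (i, j, k) :: 'r vpair)"
      by (intro bexI[of _ "\<lambda>x. kink (psum (fst x)) j"])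
  next
    fix c :: "'r vpair \<Rightarrow> real" assume "c \<in> constraints" and pos: "0 < c (ray (i, j, k))"
    then consider (A) n where "0 < n" "n \<le> CARD('r)" "c = (\<lambda>x. kink (psum (fst x)) n)"
      | (B) n where "0 < n" "n \<le> CARD('r)" "c = (\<lambda>x. kink (psum (snd x)) n)"
      | (D) n where "n \<le> CARD('r)" "c = (\<lambda>x. psum (fst x) n - psum (snd x) n)"
      | (E) "c = (\<lambda>x. psum (snd x) CARD('r) - psum (fst x) CARD('r))"
      by (auto simp: constraints_def)
    then show "0 < c x"
    proof cases
      case A
      then have "n = j" using pos kink_ray(1)[OF t, of n] by (auto split: if_splits)
      then show ?thesis using A jk by (simp add: L_def)
    next
      case B
      then have "n = i \<or> n = k" using pos kink_ray(2)[OF t, of n] by (auto split: if_splits)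
      then show ?thesis using B jk i by (auto simp: M_def)
    next
      case D
      then have "i < n \<and> n < k \<and> j < k"
        using pos psum_ray_diff[OF t, of n] ijk by (cases "j = k") (auto split: if_splits)
      then show ?thesis using D g[of n] by (simp add: L_def M_def)
    next
      case E
      then show ?thesis using pos psum_ray_diff[OF t, of "CARD('r)"] ijk by auto
    qed
  qed
qed

section \<open>The polytope as the convex hull of normalised rays\<close>

definition vsize :: "'r::{finite,linorder} vpair \<Rightarrow> real" where
  "vsize x = psum (fst x) CARD('r) + psum (snd x) CARD('r)"

lemma linear_vsize: "linear vsize"
  by (auto intro!: linearI simp: vsize_def psum_add psum_scaleR algebra_simps)

lemma kostka_polytope_eq: "kostka_polytope = kostka_cone \<inter> {x. vsize x = 1}"
  by (auto simp: kostka_polytope_def vsize_def psum_total sum.distrib)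

text \<open>Beyond making the normalisation legitimate, the bound 1 ensures that normalising never
  stretches a ray.\<close>

lemma vsize_ray_ge_1:
  assumes "t \<in> triples CARD('r::{finite,linorder})"
  shows "1 \<le> vsize (ray t :: 'r vpair)"
proof -
  obtain i j k where t': "t = (i, j, k)" by (cases t)
  note t = assms[unfolded t']
  have ijk: "i < j" "j \<le> k" "k \<le> CARD('r)" using t by (auto simp: triples_def)
  have "1 * 1 \<le> real (k - i) * real j" using ijk by (intro mult_mono) auto
  then have "1 \<le> psum (fst (ray t :: 'r vpair)) CARD('r)"
    using psum_ray(1)[OF t, of "CARD('r)"] ijk by (simp add: t' min_absorb2 of_nat_diff)
  moreover have "0 \<le> psum (snd (ray t :: 'r vpair)) CARD('r)"
    using psum_ray(2)[OF t, of "CARD('r)"] by (simp add: t')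
  ultimately show ?thesis by (simp add: vsize_def)
qed

definition vertex :: "nat \<times> nat \<times> nat \<Rightarrow> 'r::{finite,linorder} vpair" where
  "vertex t = (1 / vsize (ray t :: 'r vpair)) *\<^sub>R ray t"

lemma psum_real_vec_atMost: "psum (real_vec x) (Suc (rk k)) = real (\<Sum>i\<le>k. x $ i)"
proof -
  have "rk i < Suc (rk k) \<longleftrightarrow> i \<le> k" for i
    using rk_less_iff[of k i] by (simp add: less_Suc_eq_le flip: not_less)
  then have "{i. rk i < Suc (rk k)} = {..k}" by auto
  then show ?thesis by (simp add: psum_def real_vec_def)
qed

lemma psum_real_vec_UNIV:
  "psum (real_vec (x :: (nat, 'r::{finite,linorder}) vec)) CARD('r) = real (\<Sum>i\<in>UNIV. x $ i)"
  by (simp add: psum_total real_vec_def)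

text \<open>The solution set of the inequalities is convex and contains the generators.\<close>

lemma kostka_cone_constraints:
  fixes x :: "'r::{finite,linorder} vpair"
  assumes "x \<in> kostka_cone"
  shows "\<forall>c\<in>constraints. 0 \<le> c x"
proof -
  have "convex {x :: 'r vpair. \<forall>c\<in>constraints. 0 \<le> c x}"
  proof (rule convexI)
    fix x y :: "'r vpair" and u v :: real
    assume "x \<in> {x. \<forall>c\<in>constraints. 0 \<le> c x}" "y \<in> {x. \<forall>c\<in>constraints. 0 \<le> c x}" "0 \<le> u" "0 \<le> v"
    then show "u *\<^sub>R x + v *\<^sub>R y \<in> {x. \<forall>c\<in>constraints. 0 \<le> c x}"
      by (simp add: linear_add[OF linear_constraints] linear_scale[OF linear_constraints])
  qed
  moreover have "\<forall>c\<in>constraints. 0 \<le> c (real_vec lam, real_vec mu)"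
    if lam: "lam \<in> Par n" and mu: "mu \<in> Par n" and dom: "dominates lam mu"
    for lam mu :: "(nat, 'r) vec" and n
    unfolding constraints_nonneg_iff fst_conv snd_conv
  proof (intro conjI allI impI)
    fix m assume m: "0 < m" "m \<le> CARD('r)"
    show "0 \<le> kink (psum (real_vec lam)) m" "0 \<le> kink (psum (real_vec mu)) m"
      using lam mu m by (auto intro!: kink_psum_nonneg simp: Par_def real_vec_def antimono_def)
  next
    fix m assume m: "m \<le> CARD('r)"
    show "psum (real_vec mu) m \<le> psum (real_vec lam) m"
    proof (cases m)
      case (Suc m')
      then obtain k :: 'r where k: "rk k = m'" using m rk_surj by (metis Suc_le_eq)
      have "(\<Sum>i\<le>k. mu $ i) \<le> (\<Sum>i\<le>k. lam $ i)" using dom by (simp add: dominates_def)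
      then show ?thesis unfolding Suc k[symmetric] psum_real_vec_atMost by linarith
    qed simp
  next
    show "psum (real_vec lam) CARD('r) = psum (real_vec mu) CARD('r)"
      using lam mu unfolding psum_real_vec_UNIV by (simp add: Par_def)
  qed
  ultimately have "kostka_cone \<subseteq> {x :: 'r vpair. \<forall>c\<in>constraints. 0 \<le> c x}"
    unfolding kostka_cone_def by (intro hull_minimal) auto
  then show ?thesis using assms by blast
qed

text \<open>\<open>kostka_cone\<close> is defined as a convex hull only, so scaling has to be
  justified: the vertex is a convex combination of the generators \<open>ray t\<close> and 0,
  because \<open>vsize (ray t)\<close> is at least 1.\<close>

lemma vertex_in_kostka_cone:
  assumes t: "t \<in> triples CARD('r::{finite,linorder})"
  shows "(vertex t :: 'r vpair) \<in> kostka_cone"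
proof -
  let ?G = "{(real_vec lam, real_vec mu) |(lam :: (nat, 'r) vec) mu n.
      lam \<in> Par n \<and> mu \<in> Par n \<and> dominates lam mu}"
  have anti: "antimono (\<lambda>l. (omega j :: (nat, 'r) vec) $ l)" for j
  proof (rule antimonoI)
    fix l m :: 'r assume "l \<le> m"
    then have "rk l \<le> rk m" using rk_less_iff[of m l] by (simp add: not_less[symmetric])
    then show "(omega j :: (nat, 'r) vec) $ m \<le> omega j $ l" by (simp add: omega_def)
  qed
  obtain i j k where t': "t = (i, j, k)" by (cases t)
  have al: "antimono (\<lambda>l. (ray_lam t :: (nat, 'r) vec) $ l)"
    using anti[of j] by (auto simp: ray_lam_def t' antimono_def)
  have am: "antimono (\<lambda>l. (ray_mu t :: (nat, 'r) vec) $ l)"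
    using anti[of i] anti[of k] by (auto simp: ray_mu_def t' antimono_def intro!: add_mono mult_le_mono2)
  have ray: "\<forall>c\<in>constraints. 0 \<le> c (ray t :: 'r vpair)" using constraints_ray_nonneg t by blast
  note ray = ray[unfolded constraints_nonneg_iff ray_def fst_conv snd_conv]
  have eq: "(\<Sum>i\<in>UNIV. (ray_lam t :: (nat, 'r) vec) $ i) = (\<Sum>i\<in>UNIV. (ray_mu t :: (nat, 'r) vec) $ i)"
    using ray unfolding psum_real_vec_UNIV by linarith
  have "dominates (ray_lam t :: (nat, 'r) vec) (ray_mu t)"
    unfolding dominates_def
  proof
    fix l :: 'r
    have "psum (real_vec (ray_mu t :: (nat, 'r) vec)) (Suc (rk l)) 
        \<le> psum (real_vec (ray_lam t :: (nat, 'r) vec)) (Suc (rk l))"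
      using ray rk_less_CARD[of l] by (meson Suc_leI)
    then show "(\<Sum>i\<le>l. (ray_mu t :: (nat, 'r) vec) $ i) \<le> (\<Sum>i\<le>l. (ray_lam t :: (nat, 'r) vec) $ i)"
      unfolding psum_real_vec_atMost by linarith
  qed
  then have "(ray t :: 'r vpair) \<in> ?G"
    unfolding ray_def Par_def using al am eq by blast
  moreover have "(0 :: 'r vpair) \<in> ?G"
  proof -
    have "(0 :: 'r vpair) = (real_vec 0, real_vec 0)" by (simp add: real_vec_def vec_eq_iff zero_prod_def)
    moreover have "(0 :: (nat, 'r) vec) \<in> Par 0" "dominates (0 :: (nat, 'r) vec) 0"
      by (auto simp: Par_def dominates_def antimono_def)
    ultimately show ?thesis by blast
  qed
  ultimately have "(ray t :: 'r vpair) \<in> kostka_cone" "(0 :: 'r vpair) \<in> kostka_cone"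
    unfolding kostka_cone_def by (blast intro: hull_inc)+
  moreover have "convex (kostka_cone :: 'r vpair set)" by (simp add: kostka_cone_def)
  ultimately have "u *\<^sub>R ray t + (1 - u) *\<^sub>R 0 \<in> (kostka_cone :: 'r vpair set)" if "0 \<le> u" "u \<le> 1" for u
    using that by (intro convexD) auto
  from this[of "1 / vsize (ray t :: 'r vpair)"] show ?thesis
    using vsize_ray_ge_1[OF t] by (simp add: vertex_def)
qed

lemma kostka_polytope_eq_hull:
  "kostka_polytope = convex hull (vertex ` triples CARD('r) :: 'r::{finite,linorder} vpair set)"
proof
  have "(vertex t :: 'r vpair) \<in> kostka_polytope" if "t \<in> triples CARD('r)" for t
  proof -
    have "vsize (vertex t :: 'r vpair) = 1"
      using vsize_ray_ge_1[OF that] by (simp add: vertex_def linear_scale[OF linear_vsize])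
    then show ?thesis using vertex_in_kostka_cone[OF that] by (simp add: kostka_polytope_eq)
  qed
  moreover have "convex (kostka_polytope :: 'r vpair set)"
  proof -
    have "convex {x :: 'r vpair. vsize x = 1}"
      by (rule convexI) (simp add: linear_add[OF linear_vsize] linear_scale[OF linear_vsize])
    then show ?thesis unfolding kostka_polytope_eq kostka_cone_def by (intro convex_Int) auto
  qed
  ultimately show "convex hull (vertex ` triples CARD('r) :: 'r vpair set) \<subseteq> kostka_polytope"
    by (intro hull_minimal) auto
next
  show "kostka_polytope \<subseteq> convex hull (vertex ` triples CARD('r) :: 'r vpair set)"
  proof
    fix x :: "'r vpair" assume "x \<in> kostka_polytope"
    then have x: "\<forall>c\<in>constraints. 0 \<le> c x" "vsize x = 1"
      unfolding kostka_polytope_eq using kostka_cone_constraints by blast+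
    obtain a where a: "\<forall>t\<in>triples CARD('r). 0 \<le> a t" "x = (\<Sum>t\<in>triples CARD('r). a t *\<^sub>R ray t)"
      using polyhedral_cone_generated[of constraints "triples CARD('r)" ray x]
        finite_constraints finite_triples linear_constraints constraints_ray_nonneg
        constraints_ray_pos x(1) by blast
    \<comment> \<open>Absorbing the sizes turns the conic coefficients into convex ones: they add up
      to \<open>vsize x = 1\<close>.\<close>
    define b where "b t = a t * vsize (ray t :: 'r vpair)" for t
    have "(\<Sum>t\<in>triples CARD('r). b t *\<^sub>R vertex t)
        \<in> convex hull (vertex ` triples CARD('r) :: 'r vpair set)"
    proof (rule convex_sum[OF finite_triples convex_convex_hull])
      show "0 \<le> b t" if "t \<in> triples CARD('r)" for t
        using a(1) vsize_ray_ge_1[OF that] that by (simp add: b_def)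
      show "sum b (triples CARD('r)) = 1"
        using x(2) by (simp add: a(2) b_def linear_sum[OF linear_vsize] linear_scale[OF linear_vsize])
    qed (intro hull_inc imageI)
    also have "(\<Sum>t\<in>triples CARD('r). b t *\<^sub>R vertex t) = x"
      unfolding a(2) by (rule sum.cong[OF refl])
        (use vsize_ray_ge_1[where 'r = 'r] in \<open>fastforce simp: b_def vertex_def\<close>)
    finally show "x \<in> convex hull (vertex ` triples CARD('r) :: 'r vpair set)" .
  qed
qed

section \<open>Vertices spanning a given dimension\<close>

text \<open>Adjoining the origin turns linear into affine dimension and raises the latter by at most
  one.\<close>

lemma dim_le_aff_dim_Suc:
  fixes S :: "'a::euclidean_space set"
  shows "int (dim S) \<le> aff_dim S + 1"
proof -
  have "int (dim S) = aff_dim (insert 0 S)"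
    by (simp add: aff_dim_zero hull_inc dim_insert span_0)
  also have "\<dots> \<le> aff_dim S + 1" by (simp add: aff_dim_insert)
  finally show ?thesis .
qed

text \<open>Normalising does not move kinks. The coefficient \<open>k - j\<close> at
  \<open>i\<close> vanishes only if \<open>j = k\<close>, and then \<open>i = 0\<close> is excluded
  by \<open>0 < n\<close>.\<close>

lemma kink_vertex:
  fixes i j k n :: nat
  assumes t: "(i, j, k) \<in> triples CARD('r::{finite,linorder})" and "0 < n"
  shows "kink (psum (fst (vertex (i, j, k) :: 'r vpair))) n \<noteq> 0 \<longleftrightarrow> n = j"
    and "kink (psum (snd (vertex (i, j, k) :: 'r vpair))) n \<noteq> 0 \<longleftrightarrow> n = i \<or> n = k"
proof -
  have scale: "kink (psum (fst (vertex (i, j, k) :: 'r vpair))) n =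
      (1 / vsize (ray (i, j, k) :: 'r vpair)) * kink (psum (fst (ray (i, j, k) :: 'r vpair))) n"
    "kink (psum (snd (vertex (i, j, k) :: 'r vpair))) n =
      (1 / vsize (ray (i, j, k) :: 'r vpair)) * kink (psum (snd (ray (i, j, k) :: 'r vpair))) n"
    unfolding vertex_def
    by (simp_all only: linear_scale[OF linear_kink_psum(1)] linear_scale[OF linear_kink_psum(2)]
        real_scaleR_def)
  show "kink (psum (fst (vertex (i, j, k) :: 'r vpair))) n \<noteq> 0 \<longleftrightarrow> n = j"
    "kink (psum (snd (vertex (i, j, k) :: 'r vpair))) n \<noteq> 0 \<longleftrightarrow> n = i \<or> n = k"
    using t \<open>0 < n\<close> vsize_ray_ge_1[OF t] unfolding scale kink_ray[OF t \<open>0 < n\<close>]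
    by (auto simp: triples_def)
qed

text \<open>Fixing first \<open>j\<close>, then \<open>k\<close>, lowers the dimension by at least
  \<open>a - 1\<close> and \<open>b - 1\<close>; the remaining vertices differ only in
  \<open>i\<close> and are independent.\<close>

lemma card_triples_le:
  assumes A: "A \<subseteq> triples CARD('r::{finite,linorder})" and ne: "A \<noteq> {}"
  shows "\<exists>a b c. card A \<le> a * b * c \<and> a + b + c \<le> dim (vertex ` A :: 'r vpair set) + 2"
proof -
  define fi fj fk :: "nat \<times> nat \<times> nat \<Rightarrow> nat"
    where "fi = fst" and "fj = fst \<circ> snd" and "fk = snd \<circ> snd"
  have tr: "fi t < fj t" "fj t \<le> fk t" if "t \<in> A" for t
    using that A by (auto simp: triples_def fi_def fj_def fk_def)
  have kv: "kink (psum (fst (vertex t :: 'r vpair))) n \<noteq> 0 \<longleftrightarrow> n = fj t"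
    "kink (psum (snd (vertex t :: 'r vpair))) n \<noteq> 0 \<longleftrightarrow> n = fi t \<or> n = fk t" if "t \<in> A" "0 < n" for t n
  proof -
    have "(fi t, fj t, fk t) = t" by (simp add: fi_def fj_def fk_def)
    moreover have "t \<in> triples CARD('r)" using that A by blast
    ultimately show "kink (psum (fst (vertex t :: 'r vpair))) n \<noteq> 0 \<longleftrightarrow> n = fj t"
      "kink (psum (snd (vertex t :: 'r vpair))) n \<noteq> 0 \<longleftrightarrow> n = fi t \<or> n = fk t"
      using kink_vertex[of "fi t" "fj t" "fk t" n, where 'r = 'r] that(2) by simp_all
  qed
  have finA: "finite A" using A finite_triples finite_subset by blast
  obtain t1 where t1: "t1 \<in> A" "card A \<le> card (fj ` A) * card {t \<in> A. fj t = fj t1}"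
    using card_le_image_times_fibre[OF finA ne, of fj] by blast
  define A1 where "A1 = {t \<in> A. fj t = fj t1}"
  have A1: "finite A1" "t1 \<in> A1" "A1 \<subseteq> A" using finA t1 by (auto simp: A1_def)
  have d1: "dim (vertex ` A1 :: 'r vpair set) + card (fj ` A) \<le> dim (vertex ` A :: 'r vpair set) + 1"
    unfolding A1_def
  proof (rule dim_fibre_le[where g = "\<lambda>n x. kink (psum (fst x)) n"])
    fix t n assume t: "t \<in> A" and n: "n \<in> fj ` A"
    have "0 < n" using n tr(1) by (metis gr_zeroI imageE not_less0)
    then show "kink (psum (fst (vertex t :: 'r vpair))) n \<noteq> 0 \<longleftrightarrow> fj t = n"
      using kv(1)[of t n] t by auto
  qed (use finA t1 linear_kink_psum in auto)
  obtain t2 where t2: "t2 \<in> A1" "card A1 \<le> card (fk ` A1) * card {t \<in> A1. fk t = fk t2}"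
    using card_le_image_times_fibre[OF A1(1), of fk] A1(2) by blast
  define A2 where "A2 = {t \<in> A1. fk t = fk t2}"
  have A2: "finite A2" "t2 \<in> A2" "A2 \<subseteq> A1" using A1 t2 by (auto simp: A2_def)
  have d2: "dim (vertex ` A2 :: 'r vpair set) + card (fk ` A1) \<le> dim (vertex ` A1 :: 'r vpair set) + 1"
    unfolding A2_def
  proof (rule dim_fibre_le[where g = "\<lambda>n x. kink (psum (snd x)) n"])
    fix t n assume t: "t \<in> A1" and n: "n \<in> fk ` A1"
    obtain s where s: "s \<in> A1" "n = fk s" using n by blast
    \<comment> \<open>With \<open>j\<close> shared, every \<open>i\<close> lies below
      \<open>j\<close> and every \<open>k\<close> does not, so a kink at \<open>n\<close> can only
      come from \<open>fk t\<close>.\<close>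
    have "fj s = fj t" "fi t < fj t" "fj s \<le> fk s" "fi s < fj s"
      using s(1) t tr[of s] tr[of t] unfolding A1_def by simp_all
    then show "kink (psum (snd (vertex t :: 'r vpair))) n \<noteq> 0 \<longleftrightarrow> fk t = n"
      using kv(2)[of t n] t s A1 by auto
  qed (use A1 t2 linear_kink_psum in auto)
  \<comment> \<open>An index \<open>i = 0\<close> is invisible to the kinks, so the triple containing it must be the one left over.\<close>
  obtain t3 where t3: "t3 \<in> A2" "\<And>t. t \<in> A2 \<Longrightarrow> fi t = 0 \<Longrightarrow> fi t3 = 0"
    using A2 by metis
  have inj: "inj_on fi A2"
  proof (rule inj_onI)
    fix s t assume "s \<in> A2" "t \<in> A2" "fi s = fi t"
    then show "s = t" unfolding A2_def A1_def by (simp add: fi_def fj_def fk_def prod_eq_iff)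
  qed
  have "dim (vertex ` {t \<in> A2. fi t = fi t3} :: 'r vpair set) + card (fi ` A2)
      \<le> dim (vertex ` A2 :: 'r vpair set) + 1"
  proof (rule dim_fibre_le[where g = "\<lambda>n x. kink (psum (snd x)) n"])
    fix t n assume t: "t \<in> A2" and n: "n \<in> fi ` A2" "n \<noteq> fi t3"
    obtain s where s: "s \<in> A2" "n = fi s" using n by blast
    have "0 < n" using t3 s n by (metis gr_zeroI)
    moreover have "fj s = fj t" "fk s = fk t" "fi s < fj s" "fj s \<le> fk s"
      using s(1) t tr[of s] unfolding A1_def A2_def by simp_all
    ultimately show "kink (psum (snd (vertex t :: 'r vpair))) n \<noteq> 0 \<longleftrightarrow> fi t = n"
      using kv(2)[of t n] t s A1 A2 by auto
  qed (use A2 t3 linear_kink_psum in auto)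
  \<comment> \<open>The left-over fibre is a single nonzero vertex of dimension 1, which cancels the
    \<open>+ 1\<close> of the fibre bound.\<close>
  moreover have "{t \<in> A2. fi t = fi t3} = {t3}" using inj t3(1) by (auto dest: inj_onD)
  moreover have "(vertex t3 :: 'r vpair) \<noteq> 0"
  proof
    assume "(vertex t3 :: 'r vpair) = 0"
    then have "kink (psum (fst (vertex t3 :: 'r vpair))) (fj t3) = 0"
      by (simp add: kink_def psum_def)
    moreover have "t3 \<in> A" using t3 A1 A2 by auto
    ultimately show False using kv(1)[of t3 "fj t3"] tr[of t3] by auto
  qed
  ultimately have d3: "card A2 \<le> dim (vertex ` A2 :: 'r vpair set)"
    using inj by (simp add: card_image dim_insert)
  have "card A \<le> card (fj ` A) * (card (fk ` A1) * card A2)"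
    using t1(2) t2(2) unfolding A1_def[symmetric] A2_def[symmetric]
    by (meson le_trans mult_le_mono2)
  then show ?thesis using d1 d2 d3
    by (intro exI[of _ "card (fj ` A)"] exI[of _ "card (fk ` A1)"] exI[of _ "card A2"])
       (simp add: mult.assoc)
qed

theorem theorem3p6:
  fixes F :: "((real ^ 'r::{finite,linorder}) \<times> (real ^ 'r::{finite,linorder})) set" and d :: nat
  assumes "d \<le> 2 * CARD('r) - 2"
    and "F face_of kostka_polytope"
    and "aff_dim F = int d"
  shows "finite {v. v extreme_point_of F} \<and>
         card {v. v extreme_point_of F} \<le> (\<Prod>i = 1..3. (d + 2 + i) div 3)"
proof -
  define X where "X = {v. v extreme_point_of F}"
  define A where "A = {t \<in> triples CARD('r). (vertex t :: 'r vpair) \<in> X}"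
  \<comment> \<open>Extreme points of a face are extreme in the polytope, hence among the points
    whose hull it is.\<close>
  have "X \<subseteq> vertex ` triples CARD('r)"
    using extreme_point_of_face[OF assms(2)] extreme_point_of_convex_hull
    unfolding X_def kostka_polytope_eq_hull by blast
  then have X: "X = vertex ` A" unfolding A_def by blast
  have sub: "A \<subseteq> triples CARD('r)" unfolding A_def by blast
  then have finA: "finite A" using finite_triples by (rule finite_subset)
  have "card A \<le> (\<Prod>i = 1..3. (d + 2 + i) div 3)"
  proof (cases "A = {}")
    case False
    obtain a b c where abc: "card A \<le> a * b * c" "a + b + c \<le> dim X + 2"
      using card_triples_le[OF sub False] unfolding X by blast
    have "X \<subseteq> F" by (auto simp: X_def extreme_point_of_def)
    then have "int (dim X) \<le> int d + 1"
      using dim_le_aff_dim_Suc[of X] aff_dim_subset[of X F] assms(3) by linarith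
    then have "a + b + c \<le> d + 3" using abc by linarith
    moreover have "{1..3} = {1, 2, 3::nat}" by auto
    \<comment> \<open>The balanced bound for sum \<open>d + 3\<close> has exactly these three
      factors.\<close>
    ultimately have "a * b * c \<le> (\<Prod>i = 1..3. (d + 2 + i) div 3)"
      using prod3_le_balanced[of a b c "d + 3"] by (simp add: algebra_simps)
    then show ?thesis using abc by linarith
  qed simp
  then show ?thesis
    using finA card_image_le[OF finA, of "vertex :: _ \<Rightarrow> 'r vpair"] order_trans
    unfolding X_def[symmetric] X by blast
qed

end
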